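(* Let $\alpha>-1$ be real, and for a constant $c$ and $m\ge1$ let $L^{(\alpha)}_{m;c}(x)=L^{(\alpha)}_m(x)+c\,L^{(\alpha)}_{m-1}(x)$. Let $n\ge2$ be an integer and let $s,t$ be constants. Then \[ \operatorname{Res}(L^{(\alpha)}_{n;s},L^{(\alpha)}_{n-1;t})=\frac{(-1)^{n(n+1)/2}}{(n+\alpha-1)^n}\prod_{k=1}^nk^{k-2n+2}\prod_{k=1}^{n-1}(k+\alpha)^k\cdot t^nL^{(\alpha)}_{n;s}\!\left(\frac{n+\alpha-1+(2n+\alpha-1)t+nst}{t}\right). \]
   Context: $L^{(\alpha)}_n$ is the $n$-th Laguerre polynomial, $L^{(\alpha)}_n(x)=\frac{e^xx^{-\alpha}}{n!}\frac{d^n}{dx^n}(e^{-x}x^{n+\alpha})=\sum_{k=0}^n\binom{n+\alpha}{n-k}\frac{(-x)^k}{k!}$. Constants are real or complex numbers. For $f=a_0\prod_{i=1}^n(x-\alpha_i)$ of degree $n$ and $g=b_0\prod_{j=1}^m(x-\beta_j)$ of degree $m$, $\operatorname{Res}(f,g)=a_0^mb_0^n\prod_{i,j}(\alpha_i-\beta_j)$. The factor $t^nL^{(\alpha)}_{n;s}(\cdots)$ is a polynomial in $t$; at $t=0$ it denotes the value of that polynomial. *)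

theory Defs
  imports Complex_Main "HOL-Computational_Algebra.Computational_Algebra"
begin

definition laguerre :: "'a::field_char_0 \<Rightarrow> nat \<Rightarrow> 'a poly" where
  "laguerre \<alpha> n =
     (\<Sum>k\<le>n. monom (((of_nat n + \<alpha>) gchoose (n - k)) * (-1) ^ k / fact k) k)"

text \<open>Intended for \<open>m \<ge> 1\<close>; the value at \<open>m = 0\<close> is an artefact of truncated subtraction.\<close>

definition laguerre_shift :: "'a::field_char_0 \<Rightarrow> nat \<Rightarrow> 'a \<Rightarrow> 'a poly" where
  "laguerre_shift \<alpha> m c = laguerre \<alpha> m + smult c (laguerre \<alpha> (m - 1))"

text \<open>Over the complex numbers every nonzero polynomial splits, so \<open>proots\<close> lists all the roots,
  with multiplicity.\<close>

definition Res :: "complex poly \<Rightarrow> complex poly \<Rightarrow> complex" where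
  "Res f g = lead_coeff f ^ degree g * lead_coeff g ^ degree f *
     (\<Prod>x\<in>#proots f. \<Prod>y\<in>#proots g. x - y)"

text \<open>For \<open>degree p \<le> n\<close>, the polynomial in \<open>t\<close> given by \<open>t ^ n * p (q t / t)\<close> away from
  \<open>t = 0\<close> (see \<open>poly_scaled_comp\<close>).\<close>

definition scaled_comp :: "nat \<Rightarrow> 'a::field_char_0 poly \<Rightarrow> 'a poly \<Rightarrow> 'a poly" where
  "scaled_comp n p q = (\<Sum>k\<le>n. smult (coeff p k) (q ^ k * monom 1 (n - k)))"

lemma poly_scaled_comp:
  assumes "degree p \<le> n" and "t \<noteq> 0"
  shows "poly (scaled_comp n p q) t = t ^ n * poly p (poly q t / t)"
proof -
  have "poly p x = (\<Sum>k\<le>n. coeff p k * x ^ k)" for x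
    unfolding poly_altdef using assms(1)
    by (intro sum.mono_neutral_left) (auto simp: coeff_eq_0)
  then have "t ^ n * poly p (poly q t / t) =
      (\<Sum>k\<le>n. t ^ n * (coeff p k * (poly q t / t) ^ k))"
    by (simp add: sum_distrib_left)
  also have "\<dots> = (\<Sum>k\<le>n. coeff p k * (poly q t ^ k * t ^ (n - k)))"
    using assms(2) by (intro sum.cong) (auto simp: power_divide power_diff)
  finally show ?thesis
    by (simp add: scaled_comp_def poly_sum poly_monom)
qed

lemma degree_laguerre_le: "degree (laguerre \<alpha> n) \<le> n"
  unfolding laguerre_def
  by (intro degree_sum_le) (auto intro: order.trans[OF degree_monom_le])

lemma degree_laguerre_shift_le: "degree (laguerre_shift \<alpha> n c) \<le> n"
  unfolding laguerre_shift_def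
  by (intro degree_add_le order.trans[OF degree_smult_le] degree_laguerre_le
        order.trans[OF degree_laguerre_le]) auto

end

theory Submission
  imports Defs
begin

text \<open>The resultant is \<open>lead_coeff f ^ degree g\<close> times the product of the values of \<open>g\<close> at the roots
  of \<open>f\<close>, and symmetrically with the roles exchanged up to sign. So if one argument is replaced by
  a polynomial of the same degree that agrees with it on the roots of the other, the resultant does
  not change.

  Everything then comes from the three-term recurrence
  \<open>n L_n = (2n - 1 + \<alpha> - x) L_(n-1) - A L_(n-2)\<close> with \<open>A = n + \<alpha> - 1\<close>. Put \<open>f = L_n + s L_(n-1)\<close>,
  \<open>g = L_(n-1) + t L_(n-2)\<close> and \<open>B = 2n + \<alpha> - 1 + n s\<close>. Multiplying the recurrence by \<open>t\<close> and
  eliminating \<open>L_n\<close> and \<open>L_(n-2)\<close> in favour of \<open>f\<close> and \<open>g\<close> yields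
  \<open>A g = (A + B t - t x) L_(n-1) - n t f\<close> (\<open>laguerre_shift_relation\<close>).
  At the roots of \<open>f\<close> the last term vanishes, so \<open>A ^ n Res f g\<close> splits into the product of
  \<open>A + B t - t x\<close> over the roots \<open>x\<close> of \<open>f\<close>, which is the scaled value of \<open>f\<close> divided by its
  leading coefficient (\<open>poly_scaled_comp_eq_prod_proots\<close>), and \<open>Res f L_(n-1)\<close>. Since \<open>f\<close> and \<open>L_n\<close>
  agree on the roots of \<open>L_(n-1)\<close>, the latter equals \<open>Res L_n L_(n-1)\<close>.

  At the roots of \<open>L_(n-1)\<close> the recurrence reduces to \<open>n L_n = - A L_(n-2)\<close>, which expresses
  \<open>Res L_n L_(n-1)\<close> through \<open>Res L_(n-1) L_(n-2)\<close>; iterating down to \<open>L_0 = 1\<close> gives the explicit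
  products (\<open>Res_laguerre_consecutive\<close>). The factor \<open>1 / lead_coeff f = (-1) ^ n * n!\<close> accounts for
  the difference between the sign exponents \<open>n (n - 1) / 2\<close> and \<open>n (n + 1) / 2\<close> and for one
  further power of each \<open>k\<close>.\<close>

section \<open>Resultants as products of values\<close>

lemma poly_eq_prod_proots:
  fixes p :: "complex poly"
  shows "poly p x = lead_coeff p * (\<Prod>y\<in>#proots p. x - y)"
proof -
  have "poly p x = poly (smult (lead_coeff p) (\<Prod>y\<in>#proots p. [:-y, 1:])) x"
    by (simp only: complex_poly_decompose_multiset)
  then show ?thesis
    by (simp add: poly_prod_mset image_mset.compositionality o_def)
qed

lemma Res_eq_prod_poly_right:
  "Res f g = lead_coeff f ^ degree g * (\<Prod>x\<in>#proots f. poly g x)"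
  unfolding Res_def
  by (simp add: poly_eq_prod_proots[of g] prod_mset.distrib size_proots_complex mult.assoc)

lemma prod_mset_diff_swap:
  fixes A B :: "'a::comm_ring_1 multiset"
  shows "(\<Prod>x\<in>#A. \<Prod>y\<in>#B. x - y) =
    (-1) ^ (size A * size B) * (\<Prod>y\<in>#B. \<Prod>x\<in>#A. y - x)"
proof -
  have "(\<Prod>x\<in>#A. \<Prod>y\<in>#B. x - y) = (\<Prod>x\<in>#A. \<Prod>y\<in>#B. (-1) * (y - x))"
    by simp
  also have "\<dots> = (-1) ^ (size A * size B) * (\<Prod>x\<in>#A. \<Prod>y\<in>#B. y - x)"
    unfolding prod_mset.distrib
    by (simp add: power_mult[symmetric] mult.commute)
  also have "(\<Prod>x\<in>#A. \<Prod>y\<in>#B. y - x) = (\<Prod>y\<in>#B. \<Prod>x\<in>#A. y - x)"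
    by (rule prod_mset.swap)
  finally show ?thesis .
qed

lemma Res_swap: "Res f g = (-1) ^ (degree f * degree g) * Res g f"
  unfolding Res_def
  by (subst prod_mset_diff_swap) (simp add: size_proots_complex mult_ac)

lemma Res_eq_prod_poly_left:
  "Res f g = (-1) ^ (degree f * degree g) * lead_coeff g ^ degree f *
    (\<Prod>y\<in>#proots g. poly f y)"
  by (subst Res_swap) (simp add: Res_eq_prod_poly_right)

lemma Res_cong_left:
  assumes "degree f = degree h" and "\<And>y. poly g y = 0 \<Longrightarrow> poly f y = poly h y"
  shows "Res f g = Res h g"
proof (cases "g = 0")
  case False
  then have "image_mset (poly f) (proots g) = image_mset (poly h) (proots g)"
    by (intro image_mset_cong) (simp add: assms(2))
  then show ?thesis
    by (simp add: Res_eq_prod_poly_left assms(1))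
qed (simp add: Res_eq_prod_poly_left assms(1))

text \<open>This is the homogenisation of the factorisation of \<open>p\<close>. Only the exact degree makes the
  powers of \<open>t\<close> match the linear factors; at \<open>t = 0\<close> both sides are the value at \<open>poly q 0\<close>
  of the leading term of \<open>p\<close>.\<close>

lemma poly_scaled_comp_eq_prod_proots:
  fixes p q :: "complex poly"
  shows "poly (scaled_comp (degree p) p q) t =
    lead_coeff p * (\<Prod>x\<in>#proots p. poly q t - t * x)"
proof (cases "t = 0")
  case True
  have "poly (scaled_comp (degree p) p q) 0 =
      (\<Sum>k\<le>degree p. if k = degree p then coeff p k * poly q 0 ^ k else 0)"
    unfolding scaled_comp_def poly_sum
    by (intro sum.cong) (auto simp: poly_monom)
  then show ?thesis
    using True by (simp add: size_proots_complex)
next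
  case False
  have "t ^ degree p * poly p (poly q t / t) =
      lead_coeff p * (t ^ size (proots p) * (\<Prod>x\<in>#proots p. poly q t / t - x))"
    by (simp add: poly_eq_prod_proots[of p] size_proots_complex)
  also have "t ^ size (proots p) * (\<Prod>x\<in>#proots p. poly q t / t - x) =
      (\<Prod>x\<in>#proots p. t * (poly q t / t - x))"
    by (simp add: prod_mset.distrib)
  also have "(\<lambda>x. t * (poly q t / t - x)) = (\<lambda>x. poly q t - t * x)"
    using False by (auto simp: field_simps)
  finally show ?thesis
    using False by (simp add: poly_scaled_comp)
qed

section \<open>Laguerre polynomials\<close>

lemma coeff_laguerre:
  "coeff (laguerre \<alpha> n) k =
    (if k \<le> n then ((of_nat n + \<alpha>) gchoose (n - k)) * (-1) ^ k / fact k else 0)"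
  by (simp add: laguerre_def coeff_sum)

lemma degree_laguerre [simp]: "degree (laguerre \<alpha> n) = n"
  by (intro antisym degree_laguerre_le le_degree) (simp add: coeff_laguerre)

lemma lead_coeff_laguerre: "coeff (laguerre \<alpha> n) n = (-1) ^ n / fact n"
  by (simp add: coeff_laguerre)

lemma laguerre_0 [simp]: "laguerre \<alpha> 0 = 1"
  by (simp add: laguerre_def)

lemma
  assumes "n > 0"
  shows degree_laguerre_shift: "degree (laguerre_shift \<alpha> n c) = n"
    and lead_coeff_laguerre_shift: "coeff (laguerre_shift \<alpha> n c) n = (-1) ^ n / fact n"
proof -
  show lead: "coeff (laguerre_shift \<alpha> n c) n = (-1) ^ n / fact n"
    using assms by (simp add: laguerre_shift_def coeff_laguerre)
  show "degree (laguerre_shift \<alpha> n c) = n"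
    by (intro antisym degree_laguerre_shift_le le_degree) (simp add: lead)
qed

lemma laguerre_recurrence:
  fixes \<alpha> :: "'a::field_char_0"
  shows "smult (of_nat (n + 2)) (laguerre \<alpha> (n + 2)) =
    [:2 * of_nat n + 3 + \<alpha>, -1:] * laguerre \<alpha> (n + 1)
      - smult (of_nat n + 1 + \<alpha>) (laguerre \<alpha> n)"
proof (rule poly_eqI)
  fix k
  define a where "a = of_nat n + \<alpha>"
  define d where "d = (if k = 0 then 0 else coeff (laguerre \<alpha> (n + 1)) (k - 1))"
  have "coeff ([:2 * of_nat n + 3 + \<alpha>, -1:] * laguerre \<alpha> (n + 1)) k =
      (2 * of_nat n + 3 + \<alpha>) * coeff (laguerre \<alpha> (n + 1)) k - d"
    by (cases k) (simp_all add: d_def)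
  moreover have "of_nat (n + 2) * coeff (laguerre \<alpha> (n + 2)) k =
      (2 * of_nat n + 3 + \<alpha>) * coeff (laguerre \<alpha> (n + 1)) k - d
        - (of_nat n + 1 + \<alpha>) * coeff (laguerre \<alpha> n) k"
  proof -
    consider "k \<le> n" | "k = n + 1" | "k = n + 2" | "k > n + 2" by linarith
    then show ?thesis
    proof cases
      case 1
      then obtain j where n: "n = j + k"
        by (metis add.commute le_Suc_ex)
      define C where "C = (a + 1) gchoose Suc j"
      define e :: 'a where "e = (-1) ^ k / fact k"
      \<comment> \<open>Multiplied by \<open>j + 2\<close>, each term of the claim becomes a polynomial multiple of \<open>C\<close>.\<close>
      have C0: "(a + 1) * (a gchoose j) = (of_nat j + 1) * C"
        using Suc_times_gbinomial[of j a] by (simp add: C_def add.commute)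
      have C1: "(of_nat j + 2) * ((a + 1) gchoose Suc (Suc j)) = (a - of_nat j) * C"
        using gbinomial_mult_1[of "a + 1" "Suc j"] by (simp add: C_def algebra_simps)
      have C2: "(of_nat j + 2) * ((a + 2) gchoose Suc (Suc j)) = (a + 2) * C"
        using Suc_times_gbinomial[of "Suc j" "a + 1"] by (simp add: C_def add_ac)
      have j2: "of_nat j + 2 \<noteq> (0::'a)"
        using of_nat_neq_0[of "Suc j", where 'a = 'a] by (simp add: add_ac)
      have c2: "coeff (laguerre \<alpha> (n + 2)) k = ((a + 2) gchoose Suc (Suc j)) * e"
        by (simp add: coeff_laguerre n a_def e_def add_ac)
      have c1: "coeff (laguerre \<alpha> (n + 1)) k = C * e"
        by (simp add: coeff_laguerre n a_def e_def C_def add_ac)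
      have c0: "coeff (laguerre \<alpha> n) k = (a gchoose j) * e"
        by (simp add: coeff_laguerre n a_def e_def)
      \<comment> \<open>The factor \<open>k\<close> turns \<open>1 / k!\<close> into \<open>1 / (k - 1)!\<close>, and for \<open>k = 0\<close> it makes the
        right-hand side vanish as \<open>d\<close> does.\<close>
      have d: "d = - (of_nat k * ((a + 1) gchoose Suc (Suc j)) * e)"
      proof (cases k)
        case (Suc i)
        have "a + 1 = of_nat (n + 1) + \<alpha>" by (simp add: a_def)
        then show ?thesis
          by (simp add: Suc d_def coeff_laguerre n e_def Suc_diff_le del: of_nat_Suc of_nat_add)
      qed (simp add: d_def)
      have "(of_nat j + 2) * (of_nat (n + 2) * ((a + 2) gchoose Suc (Suc j))) =
          (of_nat j + 2) * ((a + of_nat n + 3) * C + of_nat k * ((a + 1) gchoose Suc (Suc j))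
            - (a + 1) * (a gchoose j))"
        using C0 C1 C2 unfolding n of_nat_add of_nat_numeral by algebra
      then have "of_nat (n + 2) * ((a + 2) gchoose Suc (Suc j)) =
          (a + of_nat n + 3) * C + of_nat k * ((a + 1) gchoose Suc (Suc j))
            - (a + 1) * (a gchoose j)"
        using j2 by simp
      from arg_cong[OF this, of "\<lambda>x. x * e"] show ?thesis
        unfolding c2 c1 c0 d by (simp add: a_def algebra_simps)
    next
      case 2
      then show ?thesis
        using of_nat_neq_0[of n, where 'a = 'a]
        by (simp add: d_def coeff_laguerre divide_simps) (simp add: algebra_simps)
    next
      case 3
      then show ?thesis
        using of_nat_neq_0[of "Suc n", where 'a = 'a]
        by (simp add: d_def coeff_laguerre divide_simps add_ac)
    next
      case 4
      then show ?thesis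
        by (simp add: d_def coeff_laguerre)
    qed
  qed
  ultimately show "coeff (smult (of_nat (n + 2)) (laguerre \<alpha> (n + 2))) k =
      coeff ([:2 * of_nat n + 3 + \<alpha>, -1:] * laguerre \<alpha> (n + 1)
        - smult (of_nat n + 1 + \<alpha>) (laguerre \<alpha> n)) k"
    by simp
qed

lemma poly_laguerre_recurrence:
  fixes \<alpha> :: "'a::field_char_0"
  shows "of_nat (n + 2) * poly (laguerre \<alpha> (n + 2)) x =
    (2 * of_nat n + 3 + \<alpha> - x) * poly (laguerre \<alpha> (n + 1)) x
      - (of_nat n + 1 + \<alpha>) * poly (laguerre \<alpha> n) x"
  using arg_cong[OF laguerre_recurrence, of "\<lambda>p. poly p x"]
  by (simp add: algebra_simps)

text \<open>Multiply the recurrence by \<open>t\<close> and substitute for its two outer terms: \<open>L_(n+2)\<close> is the first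
  shifted polynomial minus \<open>s L_(n+1)\<close>, and \<open>t L_n\<close> is the second one minus \<open>L_(n+1)\<close>.\<close>

lemma laguerre_shift_relation:
  fixes \<alpha> :: "'a::field_char_0"
  shows "(of_nat n + 1 + \<alpha>) * poly (laguerre_shift \<alpha> (n + 1) t) x =
    (of_nat n + 1 + \<alpha> + (2 * of_nat n + 3 + \<alpha> + of_nat (n + 2) * s) * t - t * x)
        * poly (laguerre \<alpha> (n + 1)) x
      - of_nat (n + 2) * t * poly (laguerre_shift \<alpha> (n + 2) s) x"
proof -
  have "poly (laguerre_shift \<alpha> (n + 1) t) x =
      poly (laguerre \<alpha> (n + 1)) x + t * poly (laguerre \<alpha> n) x"
    and "poly (laguerre_shift \<alpha> (n + 2) s) x =
      poly (laguerre \<alpha> (n + 2)) x + s * poly (laguerre \<alpha> (n + 1)) x"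
    by (simp_all add: laguerre_shift_def)
  then show ?thesis
    using poly_laguerre_recurrence[of n \<alpha> x] by algebra
qed

section \<open>Consecutive Laguerre polynomials\<close>

text \<open>On the roots of \<open>L_(n+1)\<close> the recurrence makes \<open>L_(n+2)\<close> a constant multiple of \<open>L_n\<close>. The
  degree of the first argument drops by two, so two factors \<open>1 / (n+1)!\<close>, up to sign, are left over
  from the leading coefficient of \<open>L_(n+1)\<close>.\<close>

lemma Res_laguerre_step:
  "Res (laguerre \<alpha> (n + 2)) (laguerre \<alpha> (n + 1)) =
    (- (of_nat n + 1 + \<alpha>) / of_nat (n + 2)) ^ (n + 1) / fact (n + 1) ^ 2 *
    Res (laguerre \<alpha> (n + 1)) (laguerre \<alpha> n)"
proof -
  let ?L = "laguerre \<alpha>"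
  define c where "c = - (of_nat n + 1 + \<alpha>) / of_nat (n + 2)"
  have val: "poly (?L (n + 2)) y = c * poly (?L n) y" if "poly (?L (n + 1)) y = 0" for y
  proof -
    have "of_nat (n + 2) * poly (?L (n + 2)) y = - (of_nat n + 1 + \<alpha>) * poly (?L n) y"
      unfolding poly_laguerre_recurrence that by (simp only: mult_zero_right diff_0 mult_minus_left)
    moreover have "of_nat (n + 2) \<noteq> (0 :: complex)" by (subst of_nat_eq_0_iff) simp
    ultimately show ?thesis
      unfolding c_def by (metis nonzero_mult_div_cancel_left times_divide_eq_left)
  qed
  have "?L (n + 1) \<noteq> 0"
    using degree_laguerre[of \<alpha> "n + 1"] by (metis add_is_0 degree_0 one_neq_zero)
  then have "image_mset (poly (?L (n + 2))) (proots (?L (n + 1))) =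
      image_mset (\<lambda>y. c * poly (?L n) y) (proots (?L (n + 1)))"
    by (intro image_mset_cong val) simp
  then have "(\<Prod>y\<in>#proots (?L (n + 1)). poly (?L (n + 2)) y) =
      c ^ (n + 1) * (\<Prod>y\<in>#proots (?L (n + 1)). poly (?L n) y)"
    by (simp add: prod_mset.distrib size_proots_complex)
  moreover have "even ((n + 2) * (n + 1))" by simp
  ultimately have "Res (?L (n + 2)) (?L (n + 1)) =
      coeff (?L (n + 1)) (n + 1) ^ (n + 2) * c ^ (n + 1) *
      (\<Prod>y\<in>#proots (?L (n + 1)). poly (?L n) y)"
    by (subst Res_eq_prod_poly_left) simp
  also have "coeff (?L (n + 1)) (n + 1) ^ (n + 2) =
      coeff (?L (n + 1)) (n + 1) ^ n / fact (n + 1) ^ 2"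
    by (simp add: lead_coeff_laguerre power_add power_divide power2_eq_square)
  finally show ?thesis
    unfolding Res_eq_prod_poly_right[of "?L (n + 1)" "?L n"] c_def[symmetric] degree_laguerre
    by (simp only: times_divide_eq_left times_divide_eq_right mult_ac)
qed

text \<open>The factor \<open>(n+1)!\<close>, the inverse of the leading coefficient of \<open>L_(n+1)\<close> up to sign, is the one
  that appears when a value of a polynomial of degree \<open>n + 1\<close> is written as a product over its
  roots. With it, the powers of the \<open>k\<close> take the same form as in the resultant of the shifted
  polynomials.\<close>

lemma Res_laguerre_consecutive:
  "fact (n + 1) * Res (laguerre \<alpha> (n + 1)) (laguerre \<alpha> n) =
    (-1) ^ (n * (n + 1) div 2) *
    (\<Prod>k=1..n+1. of_nat k powi (int k - 2 * int (n + 1) + 2)) *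
    (\<Prod>k=1..n. (of_nat k + \<alpha>) ^ k)"
proof (induction n)
  case 0
  then show ?case by (simp add: Res_def lead_coeff_laguerre)
next
  case (Suc n)
  define N where "N = (of_nat (n + 2) :: complex)"
  define P where "P m = (\<Prod>k=1..m. (of_nat k :: complex) powi (int k - 2 * int m + 2))" for m
  define Q where "Q = (\<Prod>k=1..n. (of_nat k + \<alpha>) ^ k)"
  define R where "R = Res (laguerre \<alpha> (n + 1)) (laguerre \<alpha> n)"
  have N: "N \<noteq> 0" unfolding N_def by (subst of_nat_eq_0_iff) simp
  have fact: "fact (n + 2) = N * fact (n + 1)"
    using fact_Suc[of "n + 1", where 'a = complex]
    by (simp only: N_def Suc_eq_plus1 add.assoc one_add_one)
  \<comment> \<open>Raising \<open>n\<close> lowers the exponent of every old factor by two.\<close>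
  have "(\<Prod>k=1..n+1. (of_nat k :: complex) powi (int k - 2 * int (n + 2) + 2)) =
      (\<Prod>k=1..n+1. of_nat k powi (int k - 2 * int (n + 1) + 2) / of_nat k ^ 2)"
  proof (intro prod.cong refl)
    fix k assume k: "k \<in> {1..n+1}"
    have "int k - 2 * int (n + 2) + 2 = (int k - 2 * int (n + 1) + 2) - 2" by simp
    then show "(of_nat k :: complex) powi (int k - 2 * int (n + 2) + 2) =
        of_nat k powi (int k - 2 * int (n + 1) + 2) / of_nat k ^ 2"
      using k by (simp only:) (subst power_int_diff; simp)
  qed
  also have "\<dots> = P (n + 1) / fact (n + 1) ^ 2"
    unfolding P_def prod_dividef prod_power_distrib[symmetric]
    by (simp only: fact_prod of_nat_prod)
  finally have "P (n + 2) =
      P (n + 1) / fact (n + 1) ^ 2 * N powi (int (n + 2) - 2 * int (n + 2) + 2)"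
    by (simp add: P_def N_def)
  also have "int (n + 2) - 2 * int (n + 2) + 2 = 1 - int (n + 1)" by simp
  also have "N powi (1 - int (n + 1)) = N / N ^ (n + 1)"
    using N by (subst power_int_diff) (simp_all only: power_int_of_nat power_int_1_right simp_thms)
  finally have P: "P (n + 2) = P (n + 1) / fact (n + 1) ^ 2 * (N / N ^ (n + 1))" .
  have sgn: "Suc n * (Suc n + 1) div 2 = n * (n + 1) div 2 + (n + 1)"
    by simp
  have IH: "fact (n + 1) * R = (-1) ^ (n * (n + 1) div 2) * P (n + 1) * Q"
    using Suc.IH by (simp add: P_def Q_def R_def)
  have c: "(- (of_nat n + 1 + \<alpha>) / N) ^ (n + 1) =
      (-1) ^ (n + 1) * (of_nat n + 1 + \<alpha>) ^ (n + 1) / N ^ (n + 1)"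
    by (metis power_divide power_minus)
  have "fact (n + 2) * Res (laguerre \<alpha> (n + 2)) (laguerre \<alpha> (n + 1)) =
      (-1) ^ (n + 1) * (of_nat n + 1 + \<alpha>) ^ (n + 1) * (N / N ^ (n + 1)) / fact (n + 1) ^ 2 *
      (fact (n + 1) * R)"
    unfolding Res_laguerre_step N_def[symmetric] c R_def[symmetric] fact
    by (simp only: times_divide_eq_left times_divide_eq_right mult_ac)
  also have "\<dots> = (-1) ^ (Suc n * (Suc n + 1) div 2) * P (n + 2) *
      (Q * (of_nat n + 1 + \<alpha>) ^ (n + 1))"
    unfolding IH P sgn power_add
    by (simp only: times_divide_eq_left times_divide_eq_right mult_ac)
  also have "Q * (of_nat n + 1 + \<alpha>) ^ (n + 1) = (\<Prod>k=1..Suc n. (of_nat k + \<alpha>) ^ k)"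
    by (simp add: Q_def add_ac)
  finally show ?case
    by (simp add: P_def)
qed

section \<open>The resultant of shifted Laguerre polynomials\<close>

theorem theorem3p5:
  fixes \<alpha> :: real and s t :: complex and n :: nat
  assumes "\<alpha> > -1" and "n \<ge> 2"
  shows "Res (laguerre_shift (complex_of_real \<alpha>) n s)
             (laguerre_shift (complex_of_real \<alpha>) (n - 1) t) =
    (-1) ^ (n * (n + 1) div 2) / (of_nat n + complex_of_real \<alpha> - 1) ^ n *
    (\<Prod>k=1..n. of_nat k powi (int k - 2 * int n + 2)) *
    (\<Prod>k=1..n-1. (of_nat k + complex_of_real \<alpha>) ^ k) *
    poly (scaled_comp n (laguerre_shift (complex_of_real \<alpha>) n s)
      [:of_nat n + complex_of_real \<alpha> - 1,
        (2 * of_nat n + complex_of_real \<alpha> - 1) + of_nat n * s:]) t"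
proof -
  obtain m where n: "n = m + 2"
    using assms(2) by (metis add.commute le_Suc_ex)
  define a where "a = complex_of_real \<alpha>"
  define f where "f = laguerre_shift a (m + 2) s"
  define g where "g = laguerre_shift a (m + 1) t"
  define L where "L = laguerre a (m + 1)"
  define A where "A = of_nat m + 1 + a"
  define B where "B = 2 * of_nat m + 3 + a + of_nat (m + 2) * s"
  define S where "S = poly (scaled_comp (m + 2) f [:A, B:]) t"
  define P where "P = (\<Prod>k=1..m+2. (of_nat k :: complex) powi (int k - 2 * int (m + 2) + 2))"
  define Q where "Q = (\<Prod>k=1..m+1. (of_nat k + a) ^ k)"
  have deg: "degree f = m + 2" "degree g = m + 1" "degree L = m + 1"
    by (simp_all add: f_def g_def L_def degree_laguerre_shift)
  have lead: "coeff f (m + 2) = (-1) ^ (m + 2) / fact (m + 2)"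
    unfolding f_def by (rule lead_coeff_laguerre_shift) simp
  have "A = complex_of_real (real m + 1 + \<alpha>)"
    by (simp add: A_def a_def)
  moreover have "real m + 1 + \<alpha> \<noteq> 0"
    using assms(1) by simp
  ultimately have A: "A \<noteq> 0"
    by (metis of_real_eq_0_iff)
  have "f \<noteq> 0" using deg by auto
  have val: "poly g x = (A + B * t - t * x) / A * poly L x" if "poly f x = 0" for x
  proof -
    have "A * poly g x = (A + B * t - t * x) * poly L x"
      using laguerre_shift_relation[of m a t x s, folded A_def B_def L_def f_def g_def] that
      by simp
    then show ?thesis
      using A by (metis nonzero_mult_div_cancel_left times_divide_eq_left)
  qed
  have "image_mset (poly g) (proots f) =
      image_mset (\<lambda>x. (A + B * t - t * x) / A * poly L x) (proots f)"
    using \<open>f \<noteq> 0\<close> by (intro image_mset_cong) (simp add: val)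
  then have "(\<Prod>x\<in>#proots f. poly g x) =
      (\<Prod>x\<in>#proots f. A + B * t - t * x) / A ^ (m + 2) * (\<Prod>x\<in>#proots f. poly L x)"
    by (simp add: prod_mset.distrib divide_inverse size_proots_complex deg power_inverse)
  moreover have "(\<Prod>x\<in>#proots f. A + B * t - t * x) = (-1) ^ (m + 2) * fact (m + 2) * S"
  proof -
    have "S = (-1) ^ (m + 2) / fact (m + 2) * (\<Prod>x\<in>#proots f. A + B * t - t * x)"
      using poly_scaled_comp_eq_prod_proots[of f "[:A, B:]" t]
      unfolding S_def deg lead by (simp add: mult.commute[of t B])
    moreover have "(-1) ^ N * fact N * ((-1) ^ N / fact N * z) = z" for N and z :: complex
      by simp
    ultimately show ?thesis
      by (simp only:)
  qed
  ultimately have "Res f g = (-1) ^ (m + 2) * fact (m + 2) * S / A ^ (m + 2) * Res f L"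
    by (simp add: Res_eq_prod_poly_right deg)
  also have "Res f L = Res (laguerre a (m + 2)) L"
    by (rule Res_cong_left) (simp_all add: deg, simp add: f_def L_def laguerre_shift_def)
  also have "(-1) ^ (m + 2) * fact (m + 2) * S / A ^ (m + 2) * \<dots> =
      (-1) ^ (m + 2) * S / A ^ (m + 2) * (fact (m + 2) * Res (laguerre a (m + 2)) L)"
    by simp
  also have "fact (m + 2) * Res (laguerre a (m + 2)) L =
      (-1) ^ ((m + 1) * (m + 2) div 2) * P * Q"
    using Res_laguerre_consecutive[of "m + 1" a] by (simp add: P_def Q_def L_def)
  finally have main: "Res f g =
      (-1) ^ (m + 2) * (-1) ^ ((m + 1) * (m + 2) div 2) / A ^ (m + 2) * P * Q * S"
    by simp
  have "(m + 2) * (m + 2 + 1) div 2 = (m + 2) + (m + 1) * (m + 2) div 2"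
    by simp
  then have "(-1) ^ (m + 2) * (-1) ^ ((m + 1) * (m + 2) div 2) =
      (-1 :: complex) ^ (n * (n + 1) div 2)"
    unfolding n by (simp only: power_add)
  moreover have "A = of_nat n + complex_of_real \<alpha> - 1"
    and "B = (2 * of_nat n + complex_of_real \<alpha> - 1) + of_nat n * s"
    by (simp_all add: A_def B_def a_def n algebra_simps)
  moreover have "m + 2 = n" "m + 1 = n - 1"
    using n by simp_all
  ultimately show ?thesis
    using main unfolding f_def g_def P_def Q_def S_def a_def by (simp only:)
qed

end
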